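(* For every $\tau\ge0$ and every $\alpha\in\mathcal A$, $$\|\Phi(\tau,\alpha)-\Psi(\tau,\alpha)\|_{P(\alpha)}\le\tau^2e^{\tau M_{tot}(\alpha)}\sum_{k=2}^m g(\tau M_k(\alpha))\sum_{i=1}^{k-1}K_{ik}(\alpha).$$
   Context: Let $A_1,\dots,A_m$ be real $n\times n$ matrices, let $\Delta^{m-1}=\{\alpha\in\mathbb R^m_{\ge0}:\sum_{i=1}^m\alpha_i=1\}$, let $\mathcal A\subseteq\Delta^{m-1}$ be compact, and let $P$ be a continuous map from $\mathcal A$ to the set of real symmetric positive definite $n\times n$ matrices. For a symmetric positive definite $Q$, $\|x\|_Q=\sqrt{x^\top Qx}$ on $\mathbb R^n$, and $\|M\|_Q=\sup_{x\ne0}\|Mx\|_Q/\|x\|_Q$ is the induced operator norm of a real $n\times n$ matrix $M$. For $\alpha\in\mathcal A$ and $\tau\ge0$ define $B_i(\alpha)=\alpha_iA_i$, $S(\alpha)=\sum_{i=1}^mB_i(\alpha)$, the monodromy $\Phi(\tau,\alpha)=e^{\tau B_m(\alpha)}\cdots e^{\tau B_1(\alpha)}$ (factors in decreasing index order from left to right), and the averaged flow $\Psi(\tau,\alpha)=e^{\tau S(\alpha)}$. Define $M_i(\alpha)=\|B_i(\alpha)\|_{P(\alpha)}$, $M_{tot}(\alpha)=\sum_{i=1}^mM_i(\alpha)$, and, for $1\le i\le k\le m$, $K_{ik}(\alpha)=\|[B_k(\alpha),B_i(\alpha)]\|_{P(\alpha)}$, where $[X,Y]=XY-YX$. The scalar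 function $g$ is $g(z)=\int_0^1(1-s)e^{2zs}\,ds$, that is, $g(z)=\frac{e^{2z}-1-2z}{4z^2}$ for $z\neq0$ and $g(0)=\frac12$. *)

theory Defs
  imports "HOL-Analysis.Analysis"
begin

(* Points of R^m are functions nat => real supported on {1..m}; on this set the product
   topology of nat => real is the Euclidean one, so compact and continuous_on have their
   usual meaning. *)
definition prob_simplex :: "nat \<Rightarrow> (nat \<Rightarrow> real) set" where
  "prob_simplex m = {\<alpha>. (\<forall>i\<in>{1..m}. 0 \<le> \<alpha> i) \<and> (\<forall>i. i \<notin> {1..m} \<longrightarrow> \<alpha> i = 0) \<and> (\<Sum>i=1..m. \<alpha> i) = 1}"

definition sym_pos_def :: "real^'n^'n \<Rightarrow> bool" where
  "sym_pos_def Q \<longleftrightarrow> transpose Q = Q \<and> (\<forall>x. x \<noteq> 0 \<longrightarrow> 0 < x \<bullet> (Q *v x))"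

definition wnorm :: "real^'n^'n \<Rightarrow> real^'n \<Rightarrow> real" where
  "wnorm Q x = sqrt (x \<bullet> (Q *v x))"

definition opnorm :: "real^'n^'n \<Rightarrow> real^'n^'n \<Rightarrow> real" where
  "opnorm Q M = (SUP x\<in>{x. x \<noteq> 0}. wnorm Q (M *v x) / wnorm Q x)"

primrec mat_pow :: "real^'n^'n \<Rightarrow> nat \<Rightarrow> real^'n^'n" where
  "mat_pow X 0 = mat 1"
| "mat_pow X (Suc k) = X ** mat_pow X k"

(* The library's exp and ( * ) do not serve here: ( * ) on vectors of vectors is entrywise. *)
definition mat_exp :: "real^'n^'n \<Rightarrow> real^'n^'n" where
  "mat_exp X = (\<Sum>k. (1 / fact k) *\<^sub>R mat_pow X k)"

definition commutator :: "real^'n^'n \<Rightarrow> real^'n^'n \<Rightarrow> real^'n^'n" where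
  "commutator X Y = X ** Y - Y ** X"

(* desc_prod F m = F m ** ... ** F 1 *)
primrec desc_prod :: "(nat \<Rightarrow> real^'n^'n) \<Rightarrow> nat \<Rightarrow> real^'n^'n" where
  "desc_prod F 0 = mat 1"
| "desc_prod F (Suc k) = F (Suc k) ** desc_prod F k"

definition Bmat :: "(nat \<Rightarrow> real^'n^'n) \<Rightarrow> (nat \<Rightarrow> real) \<Rightarrow> nat \<Rightarrow> real^'n^'n" where
  "Bmat A \<alpha> i = \<alpha> i *\<^sub>R A i"

definition Smat :: "nat \<Rightarrow> (nat \<Rightarrow> real^'n^'n) \<Rightarrow> (nat \<Rightarrow> real) \<Rightarrow> real^'n^'n" where
  "Smat m A \<alpha> = (\<Sum>i=1..m. Bmat A \<alpha> i)"

definition monodromy :: "nat \<Rightarrow> (nat \<Rightarrow> real^'n^'n) \<Rightarrow> real \<Rightarrow> (nat \<Rightarrow> real) \<Rightarrow> real^'n^'n" where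
  "monodromy m A \<tau> \<alpha> = desc_prod (\<lambda>i. mat_exp (\<tau> *\<^sub>R Bmat A \<alpha> i)) m"

definition avg_flow :: "nat \<Rightarrow> (nat \<Rightarrow> real^'n^'n) \<Rightarrow> real \<Rightarrow> (nat \<Rightarrow> real) \<Rightarrow> real^'n^'n" where
  "avg_flow m A \<tau> \<alpha> = mat_exp (\<tau> *\<^sub>R Smat m A \<alpha>)"

definition Mnorm ::
  "(nat \<Rightarrow> real^'n^'n) \<Rightarrow> ((nat \<Rightarrow> real) \<Rightarrow> real^'n^'n) \<Rightarrow> nat \<Rightarrow> (nat \<Rightarrow> real) \<Rightarrow> real" where
  "Mnorm A P i \<alpha> = opnorm (P \<alpha>) (Bmat A \<alpha> i)"

definition Mtot ::
  "nat \<Rightarrow> (nat \<Rightarrow> real^'n^'n) \<Rightarrow> ((nat \<Rightarrow> real) \<Rightarrow> real^'n^'n) \<Rightarrow> (nat \<Rightarrow> real) \<Rightarrow> real" where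
  "Mtot m A P \<alpha> = (\<Sum>i=1..m. Mnorm A P i \<alpha>)"

definition Kcomm ::
  "(nat \<Rightarrow> real^'n^'n) \<Rightarrow> ((nat \<Rightarrow> real) \<Rightarrow> real^'n^'n) \<Rightarrow> nat \<Rightarrow> nat \<Rightarrow> (nat \<Rightarrow> real) \<Rightarrow> real" where
  "Kcomm A P i k \<alpha> = opnorm (P \<alpha>) (commutator (Bmat A \<alpha> k) (Bmat A \<alpha> i))"

definition gfun :: "real \<Rightarrow> real" where
  "gfun z = integral {0..1} (\<lambda>s. (1 - s) * exp (2 * z * s))"

lemma gfun_0: "gfun 0 = 1 / 2"
proof -
  have "((\<lambda>s::real. 1 - s) has_integral ((1 - 1^2/2) - (0 - 0^2/2))) {0..1}"
    by (rule fundamental_theorem_of_calculus)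
      (auto intro!: derivative_eq_intros simp flip: has_real_derivative_iff_has_vector_derivative)
  then show ?thesis
    by (simp add: gfun_def integral_unique)
qed

lemma gfun_nonzero:
  assumes "z \<noteq> 0"
  shows "gfun z = (exp (2 * z) - 1 - 2 * z) / (4 * z^2)"
proof -
  define F where "F = (\<lambda>s::real. (1 - s) * exp (2 * z * s) / (2 * z) + exp (2 * z * s) / (4 * z^2))"
  have "((\<lambda>s. (1 - s) * exp (2 * z * s)) has_integral (F 1 - F 0)) {0..1}"
    unfolding F_def using assms
    by (intro fundamental_theorem_of_calculus)
      (auto intro!: derivative_eq_intros simp: field_simps power2_eq_square
        simp flip: has_real_derivative_iff_has_vector_derivative)
  then have "gfun z = F 1 - F 0"
    by (simp add: gfun_def integral_unique)
  also have "\<dots> = (exp (2 * z) - 1 - 2 * z) / (4 * z^2)"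
    using assms by (simp add: F_def field_simps power2_eq_square)
  finally show ?thesis .
qed

end

theory Submission
  imports Defs
begin

text \<open>
  For two matrices \<open>X\<close>, \<open>Y\<close> let \<open>T n = ordered_binomial X Y n = (\<Sum>i\<le>n. (n choose i) X\<^sup>i Y\<^sup>n\<^sup>-\<^sup>i)\<close>,
  so that \<open>e\<^sup>X e\<^sup>Y = (\<Sum>n. T n / n!)\<close>. From \<open>T (n+1) = X (T n) + (T n) Y\<close> one gets
  \<open>T (n+1) - (X+Y)\<^sup>n\<^sup>+\<^sup>1 = (X+Y) (T n - (X+Y)\<^sup>n) + [T n, Y]\<close> and
  \<open>[T (n+1), Y] = X [T n, Y] + [T n, Y] Y + [X, Y] (T n)\<close>. With \<open>s = \<parallel>X\<parallel> + \<parallel>Y\<parallel>\<close>, induction gives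
  \<open>\<parallel>T n - (X+Y)\<^sup>n\<parallel> \<le> (n choose 2) \<parallel>[X,Y]\<parallel> s\<^sup>n\<^sup>-\<^sup>2\<close>, and summation over \<open>n\<close> gives
  \<open>\<parallel>e\<^sup>X e\<^sup>Y - e\<^sup>X\<^sup>+\<^sup>Y\<parallel> \<le> \<parallel>[X,Y]\<parallel> e\<^sup>s / 2\<close>. Splitting off one factor of the monodromy at a time
  sums these errors, and \<open>1/2 \<le> g z\<close> for \<open>z \<ge> 0\<close>.
\<close>

section \<open>Cauchy products and the matrix exponential series\<close>

text \<open>Sums over the squares \<open>S1 n\<close> tend to \<open>prod u v\<close>; those over
  the triangles \<open>S2 n\<close> are the Cauchy sums. On the difference set the terms are at most
  \<open>K\<close> times products of norms, and these sum to something tending to 0 by the Cauchy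
  product of the two real series of norms. The bilinear setting makes the result applicable to
  \<open>**\<close>.\<close>

lemma (in bounded_bilinear) Cauchy_product_sums_prod:
  assumes a: "summable (\<lambda>k. norm (a k))" and sa: "a sums u"
    and b: "summable (\<lambda>k. norm (b k))" and sb: "b sums v"
  shows "(\<lambda>k. \<Sum>i\<le>k. prod (a i) (b (k - i))) sums prod u v"
proof -
  define S1 where "S1 n = {..<n} \<times> {..<n}" for n :: nat
  define S2 where "S2 n = {(i, j). i + j < n}" for n :: nat
  define f where "f = (\<lambda>(i, j). prod (a i) (b j))"
  define g where "g = (\<lambda>(i, j). norm (a i) * norm (b j))"
  have tri: "(\<Sum>(i, j)\<in>S2 n. h i j) = (\<Sum>k<n. \<Sum>i\<le>k. h i (k - i))"
    for h :: "nat \<Rightarrow> nat \<Rightarrow> 'x::comm_monoid_add" and n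
    unfolding S2_def by (rule sum.triangle_reindex)
  have fin: "finite (S1 n)" and sub: "S2 n \<subseteq> S1 n" for n
    by (auto simp: S1_def S2_def)
  obtain K where K: "\<And>x y. norm (prod x y) \<le> norm x * norm y * K"
    using pos_bounded by blast
  have "prod (sum a {..<n}) (sum b {..<n}) = sum f (S1 n)" for n
    unfolding sum_left sum_right f_def S1_def
    by (subst sum.swap) (rule sum.cartesian_product)
  then have f1: "(\<lambda>n. sum f (S1 n)) \<longlonglongrightarrow> prod u v"
    using tendsto[OF sa[unfolded sums_def] sb[unfolded sums_def]] by (simp only:)
  have g1: "(\<lambda>n. sum g (S1 n)) \<longlonglongrightarrow> (\<Sum>k. norm (a k)) * (\<Sum>k. norm (b k))"
    using tendsto_mult[OF summable_LIMSEQ[OF a] summable_LIMSEQ[OF b]]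
    by (simp add: g_def S1_def sum_product sum.cartesian_product)
  have "(\<lambda>k. \<Sum>i\<le>k. norm (a i) * norm (b (k - i))) sums ((\<Sum>k. norm (a k)) * (\<Sum>k. norm (b k)))"
    by (rule Series.Cauchy_product_sums) (use a b in auto)
  then have g2: "(\<lambda>n. sum g (S2 n)) \<longlonglongrightarrow> (\<Sum>k. norm (a k)) * (\<Sum>k. norm (b k))"
    unfolding sums_def g_def tri .
  have diff: "sum h (S1 n) - sum h (S2 n) = sum h (S1 n - S2 n)"
    for h :: "nat \<times> nat \<Rightarrow> 'x::ab_group_add" and n
    by (rule sum_diff[OF fin sub, symmetric])
  have lim: "(\<lambda>n. (sum g (S1 n) - sum g (S2 n)) * K) \<longlonglongrightarrow> 0"
    using tendsto_mult_right[OF tendsto_diff[OF g1 g2], of K] by simp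
  have "norm (sum f (S1 n) - sum f (S2 n)) \<le> (sum g (S1 n) - sum g (S2 n)) * K" for n
    unfolding diff sum_distrib_right by (rule sum_norm_le) (auto simp: f_def g_def K)
  then have "(\<lambda>n. sum f (S1 n) - sum f (S2 n)) \<longlonglongrightarrow> 0"
    by (intro Lim_null_comparison[OF always_eventually lim]) (rule allI)
  from tendsto_diff[OF f1 this] show ?thesis
    unfolding sums_def f_def tri by simp
qed

text \<open>In finite dimension every bilinear map is bounded, so bilinearity is all that has to be
  checked.\<close>

interpretation matrix_mul: bounded_bilinear "(**) :: real^'n^'n \<Rightarrow> real^'n^'n \<Rightarrow> real^'n^'n"
proof -
  have "(A + B) ** C = A ** C + B ** C" for A B C :: "real^'n^'n"
    by (simp add: matrix_matrix_mult_def vec_eq_iff sum.distrib distrib_right)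
  then have "bilinear ((**) :: real^'n^'n \<Rightarrow> real^'n^'n \<Rightarrow> real^'n^'n)"
    unfolding bilinear_def linear_iff
    by (auto simp: matrix_add_ldistrib scalar_matrix_assoc matrix_scalar_ac)
  then show "bounded_bilinear ((**) :: real^'n^'n \<Rightarrow> real^'n^'n \<Rightarrow> real^'n^'n)"
    by (simp add: bilinear_conv_bounded_bilinear)
qed

lemmas matrix_ring_simps = matrix_mul.add_left matrix_mul.add_right
  matrix_mul.diff_left matrix_mul.diff_right matrix_mul_assoc

lemma mat_pow_commute: "mat_pow X n ** X = X ** mat_pow X n"
  by (induction n) (simp_all add: matrix_mul_assoc[symmetric])

text \<open>Comparison with the real exponential series at \<open>norm X * K\<close>. Here
  \<open>norm\<close> is the Euclidean norm on matrices, so the constant \<open>K\<close> and the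
  factor \<open>norm (mat 1)\<close> have to be carried along.\<close>

lemma summable_norm_mat_pow:
  fixes X :: "real^'n^'n"
  shows "summable (\<lambda>k. norm ((1 / fact k) *\<^sub>R mat_pow X k))"
proof -
  obtain K where K: "0 \<le> K" "\<And>(Y :: real^'n^'n) (Z :: real^'n^'n). norm (Y ** Z) \<le> norm Y * norm Z * K"
    using matrix_mul.nonneg_bounded by blast
  have bd: "norm (mat_pow X k) \<le> (norm X * K) ^ k * norm (mat 1 :: real^'n^'n)" for k
  proof (induction k)
    case (Suc k)
    have "norm (mat_pow X (Suc k)) \<le> norm X * K * norm (mat_pow X k)"
      using K(2)[of X "mat_pow X k"] by (simp add: mult_ac)
    also have "\<dots> \<le> norm X * K * ((norm X * K) ^ k * norm (mat 1 :: real^'n^'n))"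
      using K(1) Suc by (intro mult_left_mono) auto
    finally show ?case by (simp add: mult_ac)
  qed simp
  have sum: "summable (\<lambda>k. inverse (fact k) * (norm X * K) ^ k * norm (mat 1 :: real^'n^'n))"
    by (intro summable_mult2 summable_exp)
  have "norm ((1 / fact k) *\<^sub>R mat_pow X k)
      \<le> inverse (fact k) * (norm X * K) ^ k * norm (mat 1 :: real^'n^'n)" for k
    using mult_left_mono[OF bd[of k], of "inverse (fact k)"] by (simp add: divide_inverse mult.assoc)
  then show ?thesis
    by (intro summable_norm_comparison_test[OF _ sum] exI allI impI)
qed

lemma mat_exp_sums: "(\<lambda>k. (1 / fact k) *\<^sub>R mat_pow X k) sums mat_exp X"
  unfolding mat_exp_def by (rule summable_sums[OF summable_norm_cancel[OF summable_norm_mat_pow]])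

lemma mat_exp_0: "mat_exp 0 = mat 1"
proof -
  have "(\<lambda>k. (1 / fact k) *\<^sub>R mat_pow (0 :: real^'a^'a) k) sums
      (\<Sum>k\<in>{0}. (1 / fact k) *\<^sub>R mat_pow (0 :: real^'a^'a) k)"
  proof (rule sums_finite)
    fix k :: nat assume "k \<notin> {0}"
    then show "(1 / fact k) *\<^sub>R mat_pow (0 :: real^'a^'a) k = 0"
      by (cases k) (simp_all add: matrix_mul.zero_left)
  qed simp
  then show ?thesis
    using sums_unique2[OF mat_exp_sums] by fastforce
qed

subsection \<open>The weighted norm\<close>

lemma sym_pos_def_commute:
  assumes "sym_pos_def Q" shows "x \<bullet> (Q *v y) = y \<bullet> (Q *v x)"
  using assms by (metis sym_pos_def_def dot_lmul_matrix inner_commute transpose_matrix_vector)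

lemma sym_pos_def_nonneg: "sym_pos_def Q \<Longrightarrow> 0 \<le> x \<bullet> (Q *v x)"
  by (cases "x = 0") (auto simp: sym_pos_def_def less_imp_le)

lemma wnorm_nonneg: "sym_pos_def Q \<Longrightarrow> 0 \<le> wnorm Q x"
  by (simp add: wnorm_def sym_pos_def_nonneg)

lemma wnorm_pos: "sym_pos_def Q \<Longrightarrow> x \<noteq> 0 \<Longrightarrow> 0 < wnorm Q x"
  by (simp add: wnorm_def sym_pos_def_def)

lemma wnorm_0 [simp]: "wnorm Q 0 = 0"
  by (simp add: wnorm_def)

lemma wnorm_scaleR: "wnorm Q (c *\<^sub>R x) = \<bar>c\<bar> * wnorm Q x"
  by (simp add: wnorm_def matrix_vector_mult_scaleR real_sqrt_mult mult.assoc[symmetric])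

lemma wnorm_Cauchy_Schwarz:
  assumes Q: "sym_pos_def Q"
  shows "x \<bullet> (Q *v y) \<le> wnorm Q x * wnorm Q y"
proof (cases "y = 0")
  case False
  define a where "a = y \<bullet> (Q *v y)"
  define b where "b = x \<bullet> (Q *v y)"
  define c where "c = x \<bullet> (Q *v x)"
  have "a > 0" using Q False by (simp add: a_def sym_pos_def_def)
  \<comment> \<open>Up to the factor \<open>a\<close>, this vector is the component of
    \<open>x\<close> that is \<open>Q\<close>-orthogonal to \<open>y\<close>.\<close>
  have "0 \<le> (a *\<^sub>R x - b *\<^sub>R y) \<bullet> (Q *v (a *\<^sub>R x - b *\<^sub>R y))"
    by (rule sym_pos_def_nonneg[OF Q])
  also have "\<dots> = a * (a * c - b\<^sup>2)"
    using sym_pos_def_commute[OF Q, of y x]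
    by (simp add: a_def b_def c_def matrix_vector_mult_diff_distrib matrix_vector_mult_scaleR
        inner_diff_left inner_diff_right algebra_simps power2_eq_square)
  finally have "b\<^sup>2 \<le> c * a"
    using \<open>a > 0\<close> by (simp add: zero_le_mult_iff mult.commute)
  then have "\<bar>b\<bar> \<le> sqrt (c * a)"
    by (metis real_sqrt_abs real_sqrt_le_iff)
  then show ?thesis by (simp add: wnorm_def a_def b_def c_def real_sqrt_mult)
qed simp

lemma wnorm_triangle:
  assumes Q: "sym_pos_def Q"
  shows "wnorm Q (x + y) \<le> wnorm Q x + wnorm Q y"
proof -
  have sq: "(wnorm Q z)\<^sup>2 = z \<bullet> (Q *v z)" for z
    by (simp add: wnorm_def sym_pos_def_nonneg[OF Q])
  have "(wnorm Q (x + y))\<^sup>2 = (wnorm Q x)\<^sup>2 + 2 * (x \<bullet> (Q *v y)) + (wnorm Q y)\<^sup>2"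
    using sym_pos_def_commute[OF Q, of y x]
    by (simp add: sq matrix_vector_right_distrib inner_add_left inner_add_right)
  also have "\<dots> \<le> (wnorm Q x + wnorm Q y)\<^sup>2"
    using wnorm_Cauchy_Schwarz[OF Q, of x y] by (simp add: power2_sum)
  finally show ?thesis
    by (rule power2_le_imp_le) (simp add: wnorm_nonneg[OF Q])
qed

lemma continuous_on_wnorm:
  "continuous_on S f \<Longrightarrow> continuous_on S (\<lambda>x. wnorm Q (f x))"
  unfolding wnorm_def
  by (intro continuous_intros bounded_linear.continuous_on[OF matrix_vector_mul_bounded_linear])

subsection \<open>The induced operator norm\<close>

text \<open>Without boundedness the real \<open>SUP\<close> in \<open>opnorm\<close> would say
  nothing. The quotient is invariant under scaling of \<open>x\<close>, hence takes all its values
  on the compact unit sphere, where it is continuous.\<close>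

lemma opnorm_bdd_above:
  assumes Q: "sym_pos_def Q"
  shows "bdd_above ((\<lambda>x. wnorm Q (M *v x) / wnorm Q x) ` {x. x \<noteq> 0})" (is "bdd_above (?r ` _)")
proof -
  have nz: "\<forall>x\<in>sphere 0 1. wnorm Q x \<noteq> 0"
    by (metis less_irrefl mem_sphere_0 norm_zero zero_neq_one wnorm_pos[OF Q])
  have "continuous_on (sphere 0 1) ?r"
    using nz
    by (intro continuous_on_divide continuous_on_wnorm continuous_on_id
        bounded_linear.continuous_on[OF matrix_vector_mul_bounded_linear])
  then have "bdd_above (?r ` sphere 0 1)"
    by (intro bounded_imp_bdd_above compact_imp_bounded compact_continuous_image compact_sphere)
  moreover have "?r ` {x. x \<noteq> 0} \<subseteq> ?r ` sphere 0 1"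
  proof clarify
    fix x :: "real^'a" assume "x \<noteq> 0"
    then have "?r x = ?r ((1 / norm x) *\<^sub>R x)" "(1 / norm x) *\<^sub>R x \<in> sphere 0 1"
      by (simp_all add: matrix_vector_mult_scaleR wnorm_scaleR)
    then show "?r x \<in> ?r ` sphere 0 1" by (rule image_eqI)
  qed
  ultimately show ?thesis by (rule bdd_above_mono)
qed

lemma wnorm_mult_le:
  assumes Q: "sym_pos_def Q"
  shows "wnorm Q (M *v x) \<le> opnorm Q M * wnorm Q x"
proof (cases "x = 0")
  case False
  then have "wnorm Q (M *v x) / wnorm Q x \<le> opnorm Q M"
    unfolding opnorm_def by (intro cSUP_upper opnorm_bdd_above[OF Q]) auto
  then show ?thesis using wnorm_pos[OF Q False] by (simp add: divide_le_eq)
qed simp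

lemma opnorm_leI:
  assumes Q: "sym_pos_def Q" and "\<And>x. wnorm Q (M *v x) \<le> b * wnorm Q x"
  shows "opnorm Q M \<le> b"
proof -
  \<comment> \<open>A supremum over a nonempty set is needed; the index type is nonempty, so an axis
    vector serves.\<close>
  have "{x :: real^'a. x \<noteq> 0} \<noteq> {}"
    by (metis (mono_tags) axis_eq_0_iff empty_iff mem_Collect_eq zero_neq_one)
  then show ?thesis
    unfolding opnorm_def using assms wnorm_pos[OF Q] by (intro cSUP_least) (auto simp: divide_le_eq)
qed

lemma opnorm_nonneg:
  assumes Q: "sym_pos_def Q" shows "0 \<le> opnorm Q M"
proof -
  have x: "axis undefined 1 \<noteq> (0 :: real^'a)" by (simp add: axis_eq_0_iff)
  have "0 \<le> opnorm Q M * wnorm Q (axis undefined 1)"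
    using wnorm_mult_le[OF Q] wnorm_nonneg[OF Q] order_trans by blast
  then show ?thesis using wnorm_pos[OF Q x] by (simp add: zero_le_mult_iff)
qed

lemma opnorm_triangle:
  assumes Q: "sym_pos_def Q"
  shows "opnorm Q (M + N) \<le> opnorm Q M + opnorm Q N"
proof (rule opnorm_leI[OF Q])
  fix x
  show "wnorm Q ((M + N) *v x) \<le> (opnorm Q M + opnorm Q N) * wnorm Q x"
    using wnorm_triangle[OF Q, of "M *v x" "N *v x"] wnorm_mult_le[OF Q, of M x]
      wnorm_mult_le[OF Q, of N x] by (simp add: matrix_vector_mult_add_rdistrib distrib_right)
qed

lemma opnorm_mult:
  assumes Q: "sym_pos_def Q"
  shows "opnorm Q (M ** N) \<le> opnorm Q M * opnorm Q N"
proof (rule opnorm_leI[OF Q])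
  fix x
  have "wnorm Q ((M ** N) *v x) \<le> opnorm Q M * wnorm Q (N *v x)"
    using wnorm_mult_le[OF Q, of M "N *v x"] by (simp add: matrix_vector_mul_assoc)
  also have "\<dots> \<le> opnorm Q M * (opnorm Q N * wnorm Q x)"
    by (intro mult_left_mono wnorm_mult_le Q opnorm_nonneg)
  finally show "wnorm Q ((M ** N) *v x) \<le> opnorm Q M * opnorm Q N * wnorm Q x"
    by (simp add: mult.assoc)
qed

text \<open>Any upper bounds may be chained this way: \<open>a\<close> and \<open>b\<close> dominate
  norms and are therefore nonnegative by themselves.\<close>

lemma opnorm_mult_le:
  assumes "sym_pos_def Q" "opnorm Q M \<le> a" "opnorm Q N \<le> b"
  shows "opnorm Q (M ** N) \<le> a * b"
  by (rule order_trans[OF opnorm_mult mult_mono']) (simp_all add: assms opnorm_nonneg)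

lemma opnorm_scaleR_le:
  assumes Q: "sym_pos_def Q"
  shows "opnorm Q (c *\<^sub>R M) \<le> \<bar>c\<bar> * opnorm Q M"
proof (rule opnorm_leI[OF Q])
  fix x
  show "wnorm Q ((c *\<^sub>R M) *v x) \<le> \<bar>c\<bar> * opnorm Q M * wnorm Q x"
    using mult_left_mono[OF wnorm_mult_le[OF Q, of M x], of "\<bar>c\<bar>"]
    by (simp add: scaleR_matrix_vector_assoc[symmetric] wnorm_scaleR mult.assoc)
qed

lemma opnorm_mat_1_le: "sym_pos_def Q \<Longrightarrow> opnorm Q (mat 1) \<le> 1"
  by (rule opnorm_leI) simp_all

lemma opnorm_0 [simp]: "sym_pos_def Q \<Longrightarrow> opnorm Q 0 = 0"
  by (rule antisym[OF opnorm_leI opnorm_nonneg]) simp_all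

lemma opnorm_sum_le:
  assumes Q: "sym_pos_def Q"
  shows "opnorm Q (\<Sum>i\<in>I. f i) \<le> (\<Sum>i\<in>I. opnorm Q (f i))"
proof (induction I rule: infinite_finite_induct)
  case (insert i I)
  have "opnorm Q (f i + sum f I) \<le> opnorm Q (f i) + (\<Sum>i\<in>I. opnorm Q (f i))"
    by (rule order_trans[OF opnorm_triangle[OF Q] add_left_mono[OF insert.IH]])
  then show ?case by (simp add: insert.hyps)
qed (simp_all add: Q)

lemma opnorm_mat_pow_le:
  assumes Q: "sym_pos_def Q" and "opnorm Q M \<le> a"
  shows "opnorm Q (mat_pow M n) \<le> a ^ n"
proof (induction n)
  case (Suc n)
  show ?case using opnorm_mult_le[OF assms Suc] by simp
qed (simp add: opnorm_mat_1_le Q)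

lemma opnorm_sums_le:
  assumes Q: "sym_pos_def Q" and F: "F sums L" and b: "b sums \<beta>"
    and le: "\<And>n. opnorm Q (F n) \<le> b n"
  shows "opnorm Q L \<le> \<beta>"
proof (rule opnorm_leI[OF Q])
  fix x
  have "continuous_on UNIV (\<lambda>M :: real^'a^'a. M *v x)"
    by (intro linear_continuous_on) (simp add: linear_conv_bounded_linear[symmetric] linear_iff
      matrix_vector_mult_add_rdistrib scaleR_matrix_vector_assoc)
  then have "continuous_on UNIV (\<lambda>M :: real^'a^'a. wnorm Q (M *v x))"
    by (rule continuous_on_wnorm)
  then have lim_F: "(\<lambda>n. wnorm Q ((\<Sum>i<n. F i) *v x)) \<longlonglongrightarrow> wnorm Q (L *v x)"
    using continuous_on_tendsto_compose[of UNIV _ "\<lambda>n. \<Sum>i<n. F i" L] F[unfolded sums_def] by simp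
  have lim_b: "(\<lambda>n. (\<Sum>i<n. b i) * wnorm Q x) \<longlonglongrightarrow> \<beta> * wnorm Q x"
    using b[unfolded sums_def] by (rule tendsto_mult_right)
  have "wnorm Q ((\<Sum>i<n. F i) *v x) \<le> (\<Sum>i<n. b i) * wnorm Q x" for n
  proof -
    have "opnorm Q (\<Sum>i<n. F i) \<le> (\<Sum>i<n. b i)"
      by (rule order_trans[OF opnorm_sum_le[OF Q] sum_mono[OF le]])
    then show ?thesis
      by (rule order_trans[OF wnorm_mult_le[OF Q] mult_right_mono[OF _ wnorm_nonneg[OF Q]]])
  qed
  then show "wnorm Q (L *v x) \<le> \<beta> * wnorm Q x"
    by (intro LIMSEQ_le[OF lim_F lim_b] exI allI impI)
qed

lemma opnorm_mat_exp_le: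
  assumes Q: "sym_pos_def Q" and a: "opnorm Q M \<le> a"
  shows "opnorm Q (mat_exp M) \<le> exp a"
proof (rule opnorm_sums_le[OF Q mat_exp_sums exp_converges])
  fix n
  have "opnorm Q ((1 / fact n) *\<^sub>R mat_pow M n) \<le> (1 / fact n) * opnorm Q (mat_pow M n)"
    using opnorm_scaleR_le[OF Q, of "1 / fact n" "mat_pow M n"] by simp
  also have "\<dots> \<le> (1 / fact n) * a ^ n"
    by (intro mult_left_mono opnorm_mat_pow_le Q a) auto
  finally show "opnorm Q ((1 / fact n) *\<^sub>R mat_pow M n) \<le> a ^ n /\<^sub>R fact n"
    by (simp add: divide_inverse mult.commute)
qed

subsection \<open>The product of two exponentials\<close>

text \<open>Defined by its recursion because the norm estimates are inductions along it; the closed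
  form serves only to identify the Cauchy product.\<close>

primrec ordered_binomial :: "real^'n^'n \<Rightarrow> real^'n^'n \<Rightarrow> nat \<Rightarrow> real^'n^'n" where
  "ordered_binomial X Y 0 = mat 1"
| "ordered_binomial X Y (Suc n) = X ** ordered_binomial X Y n + ordered_binomial X Y n ** Y"

text \<open>With the factorials absorbed into \<open>x i\<close> and \<open>y i\<close>, multiplying
  by \<open>X\<close> or \<open>Y\<close> raises an index and produces a scalar weight. The term
  \<open>z i\<close> gets weight \<open>i\<close> from the left and \<open>Suc n - i\<close> from
  the right, in total \<open>Suc n\<close>.\<close>

lemma ordered_binomial_expand:
  "ordered_binomial X Y n = fact n *\<^sub>R
    (\<Sum>i\<le>n. ((1 / fact i) *\<^sub>R mat_pow X i) ** ((1 / fact (n - i)) *\<^sub>R mat_pow Y (n - i)))"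
proof (induction n)
  case (Suc n)
  define x where "x i = (1 / fact i) *\<^sub>R mat_pow X i" for i
  define y where "y i = (1 / fact i) *\<^sub>R mat_pow Y i" for i
  have fact_cancel: "real (Suc i) * (1 / fact (Suc i)) = 1 / fact i" for i
    by (simp add: fact_Suc del: of_nat_Suc)
  have Xx: "X ** x i = real (Suc i) *\<^sub>R x (Suc i)" for i
    by (simp only: x_def matrix_mul.scaleR_right scaleR_scaleR fact_cancel mat_pow.simps)
  have Yy: "y i ** Y = real (Suc i) *\<^sub>R y (Suc i)" for i
    by (simp only: y_def matrix_mul.scaleR_left scaleR_scaleR fact_cancel mat_pow.simps mat_pow_commute)
  define z where "z i = x i ** y (Suc n - i)" for i
  have "X ** (\<Sum>i\<le>n. x i ** y (n - i)) = (\<Sum>i\<le>n. real (Suc i) *\<^sub>R z (Suc i))"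
    by (simp only: matrix_mul.sum_right matrix_mul_assoc Xx matrix_mul.scaleR_left z_def diff_Suc_Suc)
  \<comment> \<open>The added term \<open>i = 0\<close> has weight 0; on the other side the same
    holds for \<open>i = Suc n\<close>.\<close>
  also have "\<dots> = (\<Sum>i\<le>Suc n. real i *\<^sub>R z i)"
    by (subst sum.atMost_Suc_shift) simp
  finally have 1: "X ** (\<Sum>i\<le>n. x i ** y (n - i)) = \<dots>" .
  have "(\<Sum>i\<le>n. x i ** y (n - i)) ** Y = (\<Sum>i\<le>n. real (Suc n - i) *\<^sub>R z i)"
    by (simp add: matrix_mul.sum_left matrix_mul_assoc[symmetric] Yy matrix_mul.scaleR_right z_def
        Suc_diff_le del: of_nat_Suc)
  also have "\<dots> = (\<Sum>i\<le>Suc n. real (Suc n - i) *\<^sub>R z i)" by simp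
  finally have 2: "(\<Sum>i\<le>n. x i ** y (n - i)) ** Y = \<dots>" .
  have "X ** (\<Sum>i\<le>n. x i ** y (n - i)) + (\<Sum>i\<le>n. x i ** y (n - i)) ** Y
      = (\<Sum>i\<le>Suc n. real (Suc n) *\<^sub>R z i)"
    unfolding 1 2 sum.distrib[symmetric]
    by (intro sum.cong) (auto simp: scaleR_add_left[symmetric] simp del: of_nat_Suc
        simp flip: of_nat_add)
  then show ?case
    using Suc by (simp add: x_def[symmetric] y_def[symmetric] z_def matrix_mul.scaleR_left
        matrix_mul.scaleR_right scaleR_add_right[symmetric] scaleR_sum_right[symmetric] mult.commute
        del: sum.atMost_Suc of_nat_Suc)
qed simp

lemma mat_exp_mult_sums:
  "(\<lambda>n. (1 / fact n) *\<^sub>R ordered_binomial X Y n) sums (mat_exp X ** mat_exp Y)"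
  using matrix_mul.Cauchy_product_sums_prod[OF summable_norm_mat_pow mat_exp_sums
      summable_norm_mat_pow mat_exp_sums]
  by (simp add: ordered_binomial_expand)

text \<open>The bounds \<open>x\<close>, \<open>y\<close>, \<open>c\<close> are arbitrary, so that
  sums of norms can be inserted later in place of the norms of sums.\<close>

context
  fixes Q X Y :: "real^'n^'n" and x y c s :: real
  assumes Q: "sym_pos_def Q"
    and X: "opnorm Q X \<le> x" and Y: "opnorm Q Y \<le> y"
    and c: "opnorm Q (commutator X Y) \<le> c"
    and s_def: "s = x + y"
begin

lemma opnorm_add_le: "opnorm Q (X + Y) \<le> s"
  using X Y opnorm_triangle[OF Q, of X Y] by (simp add: s_def)

lemma opnorm_ordered_binomial_le: "opnorm Q (ordered_binomial X Y n) \<le> s ^ n"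
proof (induction n)
  case (Suc n)
  show ?case
    using opnorm_triangle[OF Q, of "X ** ordered_binomial X Y n" "ordered_binomial X Y n ** Y"]
      opnorm_mult_le[OF Q X Suc] opnorm_mult_le[OF Q Suc Y]
    by (simp add: s_def algebra_simps)
qed (simp add: opnorm_mat_1_le Q)

text \<open>In the recursion for the commutator the two terms containing the old one cost a factor
  \<open>x + y = s\<close>, and the new term contributes \<open>c * s ^ n\<close>.\<close>

lemma opnorm_commutator_ordered_binomial_le:
  "opnorm Q (commutator (ordered_binomial X Y n) Y) \<le> n * s ^ (n - 1) * c"
proof (induction n)
  case (Suc n)
  let ?T = "ordered_binomial X Y n"
  let ?C = "commutator ?T Y"
  have eq: "commutator (ordered_binomial X Y (Suc n)) Y = (X ** ?C + ?C ** Y) + commutator X Y ** ?T"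
    by (simp add: commutator_def matrix_ring_simps)
  have "opnorm Q (commutator (ordered_binomial X Y (Suc n)) Y)
      \<le> (opnorm Q (X ** ?C) + opnorm Q (?C ** Y)) + opnorm Q (commutator X Y ** ?T)"
    unfolding eq by (rule order_trans[OF opnorm_triangle[OF Q] add_right_mono[OF opnorm_triangle[OF Q]]])
  also have "\<dots> \<le> (x * (n * s ^ (n - 1) * c) + (n * s ^ (n - 1) * c) * y) + c * s ^ n"
    by (intro add_mono opnorm_mult_le Q X Y c Suc opnorm_ordered_binomial_le)
  also have "\<dots> = s * (n * s ^ (n - 1)) * c + c * s ^ n"
    by (simp add: s_def algebra_simps)
  also have "\<dots> = Suc n * s ^ (Suc n - 1) * c"
    \<comment> \<open>For \<open>n = 0\<close> the exponent \<open>n - 1\<close> is truncated, but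
      its coefficient \<open>n\<close> vanishes.\<close>
    by (cases n) (simp_all add: algebra_simps)
  finally show ?case .
qed (simp add: commutator_def Q)

text \<open>The errors satisfy \<open>e (n+1) \<le> s * e n + n * s ^ (n - 1) * c\<close>, and the
  coefficients add up by Pascal's rule \<open>(n choose 2) + n = (n + 1 choose 2)\<close>.\<close>

lemma opnorm_ordered_binomial_diff_le:
  "opnorm Q (ordered_binomial X Y n - mat_pow (X + Y) n) \<le> real n * (real n - 1) / 2 * s ^ (n - 2) * c"
proof (induction n)
  case (Suc n)
  let ?T = "ordered_binomial X Y n"
  let ?E = "?T - mat_pow (X + Y) n"
  have eq: "ordered_binomial X Y (Suc n) - mat_pow (X + Y) (Suc n)
      = (X + Y) ** ?E + commutator ?T Y"
    by (simp add: commutator_def matrix_ring_simps)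
  have "opnorm Q (ordered_binomial X Y (Suc n) - mat_pow (X + Y) (Suc n))
      \<le> opnorm Q ((X + Y) ** ?E) + opnorm Q (commutator ?T Y)"
    unfolding eq by (rule opnorm_triangle[OF Q])
  also have "\<dots> \<le> s * (real n * (real n - 1) / 2 * s ^ (n - 2) * c) + n * s ^ (n - 1) * c"
    by (intro add_mono opnorm_mult_le Q opnorm_add_le Suc opnorm_commutator_ordered_binomial_le)
  also have "\<dots> = real (Suc n) * (real (Suc n) - 1) / 2 * s ^ (Suc n - 2) * c"
  proof (cases "n \<ge> 2")
    case True
    then obtain k where "n = Suc (Suc k)" by (metis Suc_le_D numeral_2_eq_2 Suc_le_mono)
    then show ?thesis by (simp add: field_simps)
  next
    \<comment> \<open>The truncated exponents \<open>n - 2\<close> and \<open>Suc n - 2\<close>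
      coincide here, so these two values are checked directly.\<close>
    case False
    then have "n = 0 \<or> n = 1" by linarith
    then show ?thesis by auto
  qed
  finally show ?case .
qed (simp add: Q)

lemma opnorm_mat_exp_mult_diff_le:
  "opnorm Q (mat_exp X ** mat_exp Y - mat_exp (X + Y)) \<le> c / 2 * exp s"
proof (rule opnorm_sums_le[OF Q sums_diff[OF mat_exp_mult_sums mat_exp_sums]])
  define b where "b n = (1 / fact n) * (real n * (real n - 1) / 2 * s ^ (n - 2) * c)" for n
  \<comment> \<open>The factor \<open>n * (n - 1)\<close> cancels against the factorial; after a
    shift by two, the exponential series of \<open>s\<close> remains.\<close>
  have "b (n + 2) = c / 2 * (s ^ n /\<^sub>R fact n)" for n
    by (simp add: b_def divide_simps)
  then have "(\<lambda>n. b (n + 2)) sums (c / 2 * exp s)"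
    using sums_mult[OF exp_converges[of s], of "c / 2"] by (simp only:)
  moreover have "(\<Sum>i<2. b i) = 0"
    by (simp add: b_def numeral_2_eq_2)
  ultimately show "b sums (c / 2 * exp s)"
    unfolding sums_iff_shift by simp
  fix n
  have "opnorm Q ((1 / fact n) *\<^sub>R (ordered_binomial X Y n - mat_pow (X + Y) n))
      \<le> (1 / fact n) * opnorm Q (ordered_binomial X Y n - mat_pow (X + Y) n)"
    using opnorm_scaleR_le[OF Q, of "1 / fact n" "ordered_binomial X Y n - mat_pow (X + Y) n"]
    by simp
  also have "\<dots> \<le> b n"
    unfolding b_def by (intro mult_left_mono opnorm_ordered_binomial_diff_le) auto
  finally show "opnorm Q ((1 / fact n) *\<^sub>R ordered_binomial X Y n
      - (1 / fact n) *\<^sub>R mat_pow (X + Y) n) \<le> b n"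
    by (simp add: scaleR_diff_right)
qed

end

subsection \<open>Splitting the monodromy\<close>

lemma commutator_scaleR: "commutator (t *\<^sub>R X) (t *\<^sub>R Y) = t\<^sup>2 *\<^sub>R commutator X Y"
  by (simp add: commutator_def matrix_mul.scaleR_left matrix_mul.scaleR_right
      scaleR_diff_right power2_eq_square)

lemma commutator_sum_right: "commutator X (\<Sum>i\<in>I. f i) = (\<Sum>i\<in>I. commutator X (f i))"
  by (simp add: commutator_def matrix_mul.sum_left matrix_mul.sum_right sum_subtractf)

text \<open>Induction on the number of factors, the leftmost one being split off. Starting at
  \<open>k = 1\<close>, where the inner sum is empty, lets the induction begin with the empty
  product.\<close>

lemma desc_prod_mat_exp_diff_le:
  assumes Q: "sym_pos_def Q" and t: "t \<ge> 0"
  shows "opnorm Q (desc_prod (\<lambda>i. mat_exp (t *\<^sub>R B i)) m - mat_exp (t *\<^sub>R (\<Sum>i=1..m. B i)))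
    \<le> t\<^sup>2 * exp (t * (\<Sum>i=1..m. opnorm Q (B i)))
        * (\<Sum>k=1..m. 1 / 2 * (\<Sum>i=1..k-1. opnorm Q (commutator (B k) (B i))))"
proof (induction m)
  case 0
  show ?case by (simp add: mat_exp_0 Q)
next
  case (Suc m)
  define F where "F = desc_prod (\<lambda>i. mat_exp (t *\<^sub>R B i)) m"
  define X where "X = t *\<^sub>R B (Suc m)"
  define Y where "Y = t *\<^sub>R (\<Sum>i=1..m. B i)"
  define x where "x = t * opnorm Q (B (Suc m))"
  define y where "y = t * (\<Sum>i=1..m. opnorm Q (B i))"
  define c where "c = (\<Sum>i=1..m. opnorm Q (commutator (B (Suc m)) (B i)))"
  define R where "R = (\<Sum>k=1..m. 1 / 2 * (\<Sum>i=1..k-1. opnorm Q (commutator (B k) (B i))))"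
  have X: "opnorm Q X \<le> x"
    using opnorm_scaleR_le[OF Q, of t "B (Suc m)"] t by (simp add: X_def x_def)
  have Y: "opnorm Q Y \<le> y"
    unfolding Y_def y_def using t opnorm_scaleR_le[OF Q, of t "\<Sum>i=1..m. B i"]
      mult_left_mono[OF opnorm_sum_le[OF Q, of B "{1..m}"] t] by simp
  \<comment> \<open>The commutator is bilinear: scaling both arguments gives \<open>t^2\<close>, and
    linearity in the second splits it into the pairwise commutators.\<close>
  have "opnorm Q (commutator X Y) \<le> t\<^sup>2 * opnorm Q (commutator (B (Suc m)) (\<Sum>i=1..m. B i))"
    unfolding X_def Y_def commutator_scaleR by (rule order_trans[OF opnorm_scaleR_le[OF Q]]) simp
  also have "\<dots> \<le> t\<^sup>2 * c"
    unfolding c_def commutator_sum_right by (intro mult_left_mono opnorm_sum_le Q) simp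
  finally have c: "opnorm Q (commutator X Y) \<le> t\<^sup>2 * c" .
  have IH: "opnorm Q (F - mat_exp Y) \<le> t\<^sup>2 * exp y * R"
    using Suc by (simp add: F_def Y_def y_def R_def)
  have eq: "desc_prod (\<lambda>i. mat_exp (t *\<^sub>R B i)) (Suc m) - mat_exp (t *\<^sub>R (\<Sum>i=1..Suc m. B i))
      = mat_exp X ** (F - mat_exp Y) + (mat_exp X ** mat_exp Y - mat_exp (X + Y))"
    by (simp add: F_def X_def Y_def matrix_mul.diff_right scaleR_add_right add.commute)
  have "opnorm Q (desc_prod (\<lambda>i. mat_exp (t *\<^sub>R B i)) (Suc m) - mat_exp (t *\<^sub>R (\<Sum>i=1..Suc m. B i)))
      \<le> opnorm Q (mat_exp X ** (F - mat_exp Y)) + opnorm Q (mat_exp X ** mat_exp Y - mat_exp (X + Y))"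
    unfolding eq by (rule opnorm_triangle[OF Q])
  \<comment> \<open>Multiplying the old error by \<open>mat_exp X\<close> costs
    \<open>exp x\<close>, which turns its \<open>exp y\<close> into the same
    \<open>exp (x + y)\<close> as in the new error.\<close>
  also have "\<dots> \<le> exp x * (t\<^sup>2 * exp y * R) + t\<^sup>2 * c / 2 * exp (x + y)"
    by (intro add_mono opnorm_mult_le opnorm_mat_exp_le Q X IH
        opnorm_mat_exp_mult_diff_le[OF Q X Y c refl])
  also have "\<dots> = t\<^sup>2 * exp (y + x) * (R + 1 / 2 * c)"
    by (simp add: exp_add algebra_simps)
  finally show ?case
    by (simp add: R_def c_def x_def y_def distrib_left)
qed

section \<open>Comparison with g and conclusion\<close>

text \<open>For \<open>z \<ge> 0\<close> the integrand dominates \<open>1 - s\<close> pointwise,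
  whose integral is \<open>gfun 0\<close>.\<close>

lemma gfun_ge_half:
  assumes "z \<ge> 0" shows "1 / 2 \<le> gfun z"
proof -
  have "1 - s \<le> (1 - s) * exp (2 * z * s)" if "s \<in> {0..1}" for s
    using mult_left_mono[of 1 "exp (2 * z * s)" "1 - s"] that assms by simp
  then have "gfun 0 \<le> gfun z"
    unfolding gfun_def
    by (intro integral_le integrable_continuous_interval continuous_intros) simp
  then show ?thesis by (simp add: gfun_0)
qed

theorem lemma6:
  fixes m :: nat
    and A :: "nat \<Rightarrow> real^'n^'n"
    and \<A> :: "(nat \<Rightarrow> real) set"
    and P :: "(nat \<Rightarrow> real) \<Rightarrow> real^'n^'n"
  assumes "\<A> \<subseteq> prob_simplex m"
    and "compact \<A>"
    and "continuous_on \<A> P"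
    and "\<forall>\<alpha>\<in>\<A>. sym_pos_def (P \<alpha>)"
  shows "\<forall>\<tau>\<ge>0. \<forall>\<alpha>\<in>\<A>.
    opnorm (P \<alpha>) (monodromy m A \<tau> \<alpha> - avg_flow m A \<tau> \<alpha>)
      \<le> \<tau>^2 * exp (\<tau> * Mtot m A P \<alpha>)
          * (\<Sum>k=2..m. gfun (\<tau> * Mnorm A P k \<alpha>) * (\<Sum>i=1..k-1. Kcomm A P i k \<alpha>))"
proof (intro allI impI ballI)
  fix \<tau> :: real and \<alpha> assume \<tau>: "\<tau> \<ge> 0" and "\<alpha> \<in> \<A>"
  then have Q: "sym_pos_def (P \<alpha>)" using assms by blast
  let ?K = "\<lambda>k. \<Sum>i=1..k-1. Kcomm A P i k \<alpha>"
  \<comment> \<open>The summand \<open>k = 1\<close> is an empty inner sum, hence 0.\<close>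
  have "(\<Sum>k=1..m. 1 / 2 * ?K k) = (\<Sum>k=2..m. 1 / 2 * ?K k)"
    by (rule sum.mono_neutral_right) (auto simp: not_le less_Suc_eq numeral_2_eq_2)
  \<comment> \<open>Raising the weights from 1/2 to \<open>gfun\<close> is allowed since each
    \<open>?K k\<close> is a sum of norms, hence nonnegative.\<close>
  also have "\<dots> \<le> (\<Sum>k=2..m. gfun (\<tau> * Mnorm A P k \<alpha>) * ?K k)"
    using \<tau> Q by (intro sum_mono mult_right_mono gfun_ge_half sum_nonneg)
      (auto simp: Mnorm_def Kcomm_def opnorm_nonneg)
  finally have "\<tau>^2 * exp (\<tau> * Mtot m A P \<alpha>) * (\<Sum>k=1..m. 1 / 2 * ?K k)
      \<le> \<tau>^2 * exp (\<tau> * Mtot m A P \<alpha>) * (\<Sum>k=2..m. gfun (\<tau> * Mnorm A P k \<alpha>) * ?K k)"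
    by (intro mult_left_mono) auto
  then show "opnorm (P \<alpha>) (monodromy m A \<tau> \<alpha> - avg_flow m A \<tau> \<alpha>)
      \<le> \<tau>^2 * exp (\<tau> * Mtot m A P \<alpha>)
          * (\<Sum>k=2..m. gfun (\<tau> * Mnorm A P k \<alpha>) * ?K k)"
    using desc_prod_mat_exp_diff_le[OF Q \<tau>, of "Bmat A \<alpha>" m]
    by (simp add: monodromy_def avg_flow_def Smat_def Mtot_def Mnorm_def Kcomm_def)
qed

end
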